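(* Let $n,m\ge 1$ and let $f_1,\ldots,f_m:\mathbf{R}^n\to\mathbf{R}$ be Borel measurable functions which are either all increasing in each component of $\mathbf{x}=(x_1,\ldots,x_n)$, or all decreasing in each component of $\mathbf{x}$. Let $\mathbf{X}=(X_1,\ldots,X_n)\in\mathbf{R}^n$ be a vector of independent random variables and let $\mathbf{Y}=(Y_1,\ldots,Y_n)$ be an independent copy of $\mathbf{X}$. For each $\alpha=1,\ldots,m$ let $H_\alpha\subseteq\{1,\ldots,n\}$ and let $\mathbf{Z}_\alpha=(Z_{1,\alpha},\ldots,Z_{n,\alpha})$, where $Z_{i,\alpha}=Y_i$ if $i\in H_\alpha$ and $Z_{i,\alpha}=X_i$ if $i\notin H_\alpha$. Let $$\mathbf{U}=(f_1(\mathbf{Z}_1),\ldots,f_m(\mathbf{Z}_m)),\qquad \mathbf{V}=(f_1(\mathbf{X}),\ldots,f_m(\mathbf{X})).$$ Then for every $\mathbf{c}=(c_1,\ldots,c_m)\in\mathbf{R}^m$ and all choices of $H_\alpha\subseteq\{1,\ldots,n\}$, $\alpha=1,\ldots,m$, $$P(\mathbf{U}\ge\mathbf{c})\le P(\mathbf{V}\ge\mathbf{c})\quad\text{and}\quad P(\mathbf{U}\le\mathbf{c})\le P(\mathbf{V}\le\mathbf{c}).$$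
   Context: Inequalities between vectors are coordinate-wise. Increasing and decreasing are in the weak sense. The variables $X_1,\ldots,X_n$ need not be identically distributed. *)

theory Defs
  imports "HOL-Probability.Probability"
begin

text \<open>Vectors in Euclidean n-space are elements of \<open>real ^ 'n\<close>; the order on this type is the
  coordinate-wise one.\<close>

definition replace_coord :: "real ^ 'n \<Rightarrow> 'n \<Rightarrow> real \<Rightarrow> real ^ 'n" where
  "replace_coord x i t = (\<chi> j. if j = i then t else x $ j)"

definition increasing_in_each_component :: "(real ^ 'n \<Rightarrow> real) \<Rightarrow> bool" where
  "increasing_in_each_component f \<longleftrightarrow> (\<forall>x i. mono (\<lambda>t. f (replace_coord x i t)))"

definition decreasing_in_each_component :: "(real ^ 'n \<Rightarrow> real) \<Rightarrow> bool" where
  "decreasing_in_each_component f \<longleftrightarrow> (\<forall>x i. antimono (\<lambda>t. f (replace_coord x i t)))"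

text \<open>Measurability of \<open>X\<close> and \<open>Y\<close> is part of the library predicate \<open>indep_var\<close>.\<close>

definition (in prob_space) independent_copy :: "'b measure \<Rightarrow> ('a \<Rightarrow> 'b) \<Rightarrow> ('a \<Rightarrow> 'b) \<Rightarrow> bool" where
  "independent_copy N X Y \<longleftrightarrow> indep_var N X N Y \<and> distr M N Y = distr M N X"

definition mix_coords :: "'n set \<Rightarrow> real ^ 'n \<Rightarrow> real ^ 'n \<Rightarrow> real ^ 'n" where
  "mix_coords H x y = (\<chi> i. if i \<in> H then y $ i else x $ i)"

end

theory Submission
  imports Defs
begin

text \<open>
  Fix \<open>\<^bold>c\<close>. The event \<open>\<^bold>U \<ge> \<^bold>c\<close> says that each \<open>\<^bold>Z\<^sub>\<alpha>\<close> lies in the superlevel set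
  \<open>A\<^sub>\<alpha> = {x. f\<^sub>\<alpha> x \<ge> c\<^sub>\<alpha>}\<close>, and \<open>\<^bold>V \<ge> \<^bold>c\<close> says that \<open>\<^bold>X\<close> lies in all of them; the events with \<open>\<le>\<close>
  involve the sublevel sets instead. Monotonicity enters only through one property of these sets:
  if all coordinates but the \<open>i\<close>-th are held fixed, each \<open>A\<^sub>\<alpha>\<close> becomes a half-line, possibly
  empty or the whole line. All of these half-lines point in the same direction, so any two of them
  are comparable by inclusion, even if they come from different \<open>\<alpha>\<close> and from different values of
  the fixed coordinates.

  The sets \<open>H\<^sub>\<alpha>\<close> are emptied one coordinate at a time, which replaces \<open>Y\<^sub>i\<close> by \<open>X\<^sub>i\<close> in every
  \<open>\<^bold>Z\<^sub>\<alpha>\<close> that used \<open>Y\<^sub>i\<close>. Given all variables other than \<open>X\<^sub>i\<close> and \<open>Y\<^sub>i\<close>, the event before the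
  replacement is \<open>X\<^sub>i \<in> S, Y\<^sub>i \<in> T\<close>, where \<open>T\<close> is the intersection of the half-lines with
  \<open>i \<in> H\<^sub>\<alpha>\<close> and \<open>S\<close> of the others, and afterwards it is \<open>X\<^sub>i \<in> S \<inter> T\<close>. As \<open>S\<close> and \<open>T\<close> are again
  comparable and \<open>X\<^sub>i\<close>, \<open>Y\<^sub>i\<close> are independent with the same law \<open>\<mu>\<close>,
  \<open>\<mu> S * \<mu> T \<le> min (\<mu> S) (\<mu> T) = \<mu> (S \<inter> T)\<close>. Integrating over the remaining variables shows that
  the replacement can only increase the probability (\<open>replace_one_coordinate\<close>); once all sets
  are empty, every \<open>\<^bold>Z\<^sub>\<alpha>\<close> has become \<open>\<^bold>X\<close>.
\<close>

section \<open>Families of sets nested by inclusion\<close>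

lemma upward_closed_nested:
  fixes S T :: "'a::linorder set"
  assumes "\<And>s t. s \<in> S \<Longrightarrow> s \<le> t \<Longrightarrow> t \<in> S" and "\<And>s t. s \<in> T \<Longrightarrow> s \<le> t \<Longrightarrow> t \<in> T"
  shows "S \<subseteq> T \<or> T \<subseteq> S"
  using assms by (meson linear subsetI)

lemma downward_closed_nested:
  fixes S T :: "'a::linorder set"
  assumes "\<And>s t. s \<in> S \<Longrightarrow> t \<le> s \<Longrightarrow> t \<in> S" and "\<And>s t. s \<in> T \<Longrightarrow> t \<le> s \<Longrightarrow> t \<in> T"
  shows "S \<subseteq> T \<or> T \<subseteq> S"
  using assms by (meson linear subsetI)

text \<open>A point of the left intersection outside some \<open>T b\<close> forces \<open>T b\<close> below every \<open>S a\<close>.\<close>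

lemma intersections_nested:
  assumes "\<And>a b. a \<in> F \<Longrightarrow> b \<in> G \<Longrightarrow> S a \<subseteq> T b \<or> T b \<subseteq> S a"
  shows "{t \<in> \<Omega>. \<forall>a\<in>F. t \<in> S a} \<subseteq> {t \<in> \<Omega>. \<forall>b\<in>G. t \<in> T b}
       \<or> {t \<in> \<Omega>. \<forall>b\<in>G. t \<in> T b} \<subseteq> {t \<in> \<Omega>. \<forall>a\<in>F. t \<in> S a}"
  using assms by blast

lemma (in prob_space) emeasure_mult_le_Int_nested:
  assumes "S \<subseteq> T \<or> T \<subseteq> S"
  shows "emeasure M S * emeasure M T \<le> emeasure M (S \<inter> T)"
  using assms
proof
  assume "S \<subseteq> T"
  then show ?thesis
    using mult_left_mono[OF measure_le_1, of "emeasure M S" T] by (simp add: Int_absorb2)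
next
  assume "T \<subseteq> S"
  then show ?thesis
    using mult_right_mono[OF measure_le_1, of "emeasure M T" S] by (simp add: Int_absorb1)
qed

lemma prod_indicator_eq:
  assumes "finite I"
  shows "(\<Prod>a\<in>I. indicator (A a) (h a)) = (if \<forall>a\<in>I. h a \<in> A a then 1 else 0 :: ennreal)"
  using assms by (auto simp: indicator_def prod_zero_iff)

section \<open>Replacing one coordinate in a product space\<close>

text \<open>The analogue of \<^const>\<open>mix_coords\<close> for points of a product space, which are functions.\<close>

definition mix :: "'i set \<Rightarrow> ('i \<Rightarrow> 'b) \<Rightarrow> ('i \<Rightarrow> 'b) \<Rightarrow> 'i \<Rightarrow> 'b" where
  "mix H x y = (\<lambda>i. if i \<in> H then y i else x i)"

lemma mix_empty [simp]: "mix {} x y = x"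
  by (simp add: mix_def)

lemma mix_fun_upd:
  "mix H (x(i := s)) (y(i := t)) = (mix H x y)(i := if i \<in> H then t else s)"
  by (auto simp: mix_def)

lemma measurable_mix [measurable]:
  fixes M :: "'i \<Rightarrow> 'b measure"
  assumes "X \<in> measurable N (PiM UNIV M)" and "Y \<in> measurable N (PiM UNIV M)"
  shows "(\<lambda>\<omega>. mix H (X \<omega>) (Y \<omega>)) \<in> measurable N (PiM UNIV M)"
proof (rule measurable_PiM_single')
  fix i :: 'i
  show "(\<lambda>\<omega>. mix H (X \<omega>) (Y \<omega>) i) \<in> measurable N (M i)"
    using measurable_component_singleton[of i UNIV M, THEN measurable_compose[OF assms(1)]]
      measurable_component_singleton[of i UNIV M, THEN measurable_compose[OF assms(2)]]
    by (cases "i \<in> H") (auto simp: mix_def)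
next
  show "(\<lambda>\<omega> i. mix H (X \<omega>) (Y \<omega>) i) \<in> space N \<rightarrow> (\<Pi>\<^sub>E i\<in>UNIV. space (M i))"
    using measurable_space[OF assms(1)] measurable_space[OF assms(2)]
    by (auto simp: mix_def space_PiM PiE_iff)
qed

text \<open>The \<open>i\<close>-th coordinates of two independent points can be integrated first. Here the
  remaining coordinates are integrated over the product over \<open>- {i}\<close>; the value that such a point
  has at \<open>i\<close> itself is overwritten.\<close>

lemma (in product_prob_space) nn_integral_pair_isolate_coordinate:
  fixes i :: 'i and g :: "('i \<Rightarrow> 'a) \<Rightarrow> ('i \<Rightarrow> 'a) \<Rightarrow> ennreal"
  assumes fin: "finite (UNIV :: 'i set)"
    and g [measurable]: "case_prod g \<in> borel_measurable (PiM UNIV M \<Otimes>\<^sub>M PiM UNIV M)"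
  shows "(\<integral>\<^sup>+x. \<integral>\<^sup>+y. g x y \<partial>PiM UNIV M \<partial>PiM UNIV M) =
    (\<integral>\<^sup>+x. \<integral>\<^sup>+y. \<integral>\<^sup>+s. \<integral>\<^sup>+t. g (x(i := s)) (y(i := t)) \<partial>M i \<partial>M i \<partial>PiM (- {i}) M \<partial>PiM (- {i}) M)"
proof -
  let ?P = "PiM UNIV M" and ?Q = "PiM (- {i}) M"
  have U: "insert i (- {i}) = UNIV" by auto
  have fin': "finite (- {i})" using fin by (rule rev_finite_subset) simp
  interpret PU: prob_space ?P by (rule prob_space_PiM) (rule prob_space)
  interpret Q: prob_space ?Q by (rule prob_space_PiM) (rule prob_space)
  have split: "integral\<^sup>N ?P h = (\<integral>\<^sup>+x. \<integral>\<^sup>+s. h (x(i := s)) \<partial>M i \<partial>?Q)"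
    if "h \<in> borel_measurable ?P" for h
    using product_nn_integral_insert[OF fin', of i h] that by (simp add: U)
  have upd [measurable]: "(\<lambda>w. (X w)(i := S w)) \<in> measurable N ?P"
    if "X \<in> measurable N ?Q" "S \<in> measurable N (M i)" for X S and N :: "'c measure"
    using measurable_fun_upd[of UNIV "- {i}" i X N M S] that U by auto
  have "(\<integral>\<^sup>+x. \<integral>\<^sup>+y. g x y \<partial>?P \<partial>?P) = (\<integral>\<^sup>+x. \<integral>\<^sup>+s. \<integral>\<^sup>+y. g (x(i := s)) y \<partial>?P \<partial>M i \<partial>?Q)"
    by (rule split) measurable
  also have "\<dots> = (\<integral>\<^sup>+x. \<integral>\<^sup>+s. \<integral>\<^sup>+y. \<integral>\<^sup>+t. g (x(i := s)) (y(i := t)) \<partial>M i \<partial>?Q \<partial>M i \<partial>?Q)"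
  proof (intro nn_integral_cong split)
    fix x s assume [measurable]: "x \<in> space ?Q" "s \<in> space (M i)"
    show "g (x(i := s)) \<in> borel_measurable ?P" by measurable
  qed
  also have "\<dots> = (\<integral>\<^sup>+x. \<integral>\<^sup>+y. \<integral>\<^sup>+s. \<integral>\<^sup>+t. g (x(i := s)) (y(i := t)) \<partial>M i \<partial>M i \<partial>?Q \<partial>?Q)"
  proof (rule nn_integral_cong)
    fix x assume [measurable]: "x \<in> space ?Q"
    interpret pair_sigma_finite ?Q "M i" ..
    show "(\<integral>\<^sup>+s. \<integral>\<^sup>+y. \<integral>\<^sup>+t. g (x(i := s)) (y(i := t)) \<partial>M i \<partial>?Q \<partial>M i) =
        (\<integral>\<^sup>+y. \<integral>\<^sup>+s. \<integral>\<^sup>+t. g (x(i := s)) (y(i := t)) \<partial>M i \<partial>M i \<partial>?Q)"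
      by (rule Fubini') measurable
  qed
  finally show ?thesis .
qed

text \<open>For fixed values of the other coordinates, the left integrand is \<open>indicator S s * indicator T t\<close>
  in the \<open>i\<close>-th coordinates \<open>s\<close> and \<open>t\<close> of \<open>x\<close> and \<open>y\<close>, and the right one is
  \<open>indicator (S \<inter> T) s\<close>, so that nestedness of \<open>S\<close> and \<open>T\<close> decides. The hypothesis has to compare
  sections through different points, because the point \<open>mix (H \<alpha>) x y\<close> depends on \<open>\<alpha>\<close>. The integrand
  is a product of indicators rather than the indicator of an intersection so that its measurability
  is immediate.\<close>

lemma (in product_prob_space) replace_one_coordinate:
  fixes A :: "'m \<Rightarrow> ('i \<Rightarrow> 'a) set" and H :: "'m \<Rightarrow> 'i set" and i :: 'i
  assumes fin: "finite (UNIV :: 'i set)" and finm: "finite (UNIV :: 'm set)"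
    and A [measurable]: "\<And>\<alpha>. A \<alpha> \<in> sets (PiM UNIV M)"
    and nested: "\<And>\<alpha> \<beta> x y. {t. x(i := t) \<in> A \<alpha>} \<subseteq> {t. y(i := t) \<in> A \<beta>}
                         \<or> {t. y(i := t) \<in> A \<beta>} \<subseteq> {t. x(i := t) \<in> A \<alpha>}"
  shows "(\<integral>\<^sup>+x. \<integral>\<^sup>+y. (\<Prod>\<alpha>\<in>UNIV. indicator (A \<alpha>) (mix (H \<alpha>) x y)) \<partial>PiM UNIV M \<partial>PiM UNIV M)
    \<le> (\<integral>\<^sup>+x. \<integral>\<^sup>+y. (\<Prod>\<alpha>\<in>UNIV. indicator (A \<alpha>) (mix (H \<alpha> - {i}) x y)) \<partial>PiM UNIV M \<partial>PiM UNIV M)"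
proof -
  let ?P = "PiM UNIV M" and ?Q = "PiM (- {i}) M"
  define k :: "('m \<Rightarrow> 'i set) \<Rightarrow> ('i \<Rightarrow> 'a) \<Rightarrow> ('i \<Rightarrow> 'a) \<Rightarrow> ennreal"
    where "k H x y = (\<Prod>\<alpha>\<in>UNIV. indicator (A \<alpha>) (mix (H \<alpha>) x y))" for H x y
  have k [measurable]: "case_prod (k H) \<in> borel_measurable (?P \<Otimes>\<^sub>M ?P)" for H
    unfolding k_def by measurable
  have U: "insert i (- {i}) = UNIV" by auto
  have upd: "(\<lambda>s. x(i := s)) \<in> measurable (M i) ?P" if "x \<in> space ?Q" for x
    using measurable_fun_upd[of UNIV "- {i}" i "\<lambda>_. x" "M i" M "\<lambda>s. s"] that U by auto
  have mix_space: "mix J x y \<in> space ?Q" if "x \<in> space ?Q" "y \<in> space ?Q" for J x y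
    using that by (auto simp: mix_def space_PiM PiE_iff extensional_def)
  have key: "(\<integral>\<^sup>+s. \<integral>\<^sup>+t. k H (x(i := s)) (y(i := t)) \<partial>M i \<partial>M i)
    \<le> (\<integral>\<^sup>+s. \<integral>\<^sup>+t. k (\<lambda>\<alpha>. H \<alpha> - {i}) (x(i := s)) (y(i := t)) \<partial>M i \<partial>M i)"
    if x: "x \<in> space ?Q" and y: "y \<in> space ?Q" for x y
  proof -
    \<comment> \<open>Only \<open>\<alpha>\<close> with \<open>i \<in> H \<alpha>\<close> constrain \<open>t\<close>, and only the others constrain \<open>s\<close>. Both families may
      be empty; restricting to \<open>space (M i)\<close> gives the empty intersection its value.\<close>
    define R where "R \<alpha> = {t. (mix (H \<alpha>) x y)(i := t) \<in> A \<alpha>}" for \<alpha>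
    define S where "S = {t \<in> space (M i). \<forall>\<alpha>\<in>{\<alpha>. i \<notin> H \<alpha>}. t \<in> R \<alpha>}"
    define T where "T = {t \<in> space (M i). \<forall>\<alpha>\<in>{\<alpha>. i \<in> H \<alpha>}. t \<in> R \<alpha>}"
    have R: "{t \<in> space (M i). t \<in> R \<alpha>} \<in> sets (M i)" for \<alpha>
      using measurable_sets[OF upd[OF mix_space[OF x y]] A[of \<alpha>]]
      by (simp add: R_def vimage_def Int_def conj_commute)
    have [measurable]: "S \<in> sets (M i)" "T \<in> sets (M i)"
      unfolding S_def T_def
      by (intro sets.sets_Collect_finite_All R rev_finite_subset[OF finm] subset_UNIV)+
    have before: "k H (x(i := s)) (y(i := t)) = indicator S s * indicator T t"
      if "s \<in> space (M i)" "t \<in> space (M i)" for s t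
      using that unfolding k_def prod_indicator_eq[OF finm] mix_fun_upd
      by (auto simp: S_def T_def R_def indicator_def)
    have after: "k (\<lambda>\<alpha>. H \<alpha> - {i}) (x(i := s)) (y(i := t)) = indicator (S \<inter> T) s"
      if "s \<in> space (M i)" "t \<in> space (M i)" for s t
    proof -
      have "mix (H \<alpha> - {i}) (x(i := s)) (y(i := t)) = (mix (H \<alpha>) x y)(i := s)" for \<alpha>
        by (auto simp: mix_def)
      then show ?thesis
        using that unfolding k_def prod_indicator_eq[OF finm]
        by (auto simp: S_def T_def R_def indicator_def)
    qed
    have "(\<integral>\<^sup>+s. \<integral>\<^sup>+t. k H (x(i := s)) (y(i := t)) \<partial>M i \<partial>M i)
        = (\<integral>\<^sup>+s. \<integral>\<^sup>+t. indicator S s * indicator T t \<partial>M i \<partial>M i)"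
      by (intro nn_integral_cong before)
    also have "\<dots> = emeasure (M i) S * emeasure (M i) T"
      by (simp add: nn_integral_cmult nn_integral_multc)
    also have "\<dots> \<le> emeasure (M i) (S \<inter> T)"
      unfolding S_def T_def R_def
      by (intro M.emeasure_mult_le_Int_nested intersections_nested nested)
    also have "\<dots> = (\<integral>\<^sup>+s. \<integral>\<^sup>+t. indicator (S \<inter> T) s \<partial>M i \<partial>M i)"
      by (simp add: M.emeasure_space_1)
    also have "\<dots> = (\<integral>\<^sup>+s. \<integral>\<^sup>+t. k (\<lambda>\<alpha>. H \<alpha> - {i}) (x(i := s)) (y(i := t)) \<partial>M i \<partial>M i)"
      by (intro nn_integral_cong after[symmetric])
    finally show ?thesis .
  qed
  have "(\<integral>\<^sup>+x. \<integral>\<^sup>+y. k H x y \<partial>?P \<partial>?P) \<le> (\<integral>\<^sup>+x. \<integral>\<^sup>+y. k (\<lambda>\<alpha>. H \<alpha> - {i}) x y \<partial>?P \<partial>?P)"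
    unfolding nn_integral_pair_isolate_coordinate[OF fin k, of _ i]
    by (intro nn_integral_mono key)
  then show ?thesis by (simp add: k_def)
qed

text \<open>Removing the coordinates from all \<open>H \<alpha>\<close> in turn leaves \<open>mix {} x y = x\<close>.\<close>

lemma (in product_prob_space) emeasure_mix_le:
  fixes A :: "'m \<Rightarrow> ('i \<Rightarrow> 'a) set" and H :: "'m \<Rightarrow> 'i set"
  assumes fin: "finite (UNIV :: 'i set)" and finm: "finite (UNIV :: 'm set)"
    and A [measurable]: "\<And>\<alpha>. A \<alpha> \<in> sets (PiM UNIV M)"
    and nested: "\<And>\<alpha> \<beta> i x y. {t. x(i := t) \<in> A \<alpha>} \<subseteq> {t. y(i := t) \<in> A \<beta>}
                           \<or> {t. y(i := t) \<in> A \<beta>} \<subseteq> {t. x(i := t) \<in> A \<alpha>}"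
  shows "emeasure (PiM UNIV M \<Otimes>\<^sub>M PiM UNIV M)
      {w \<in> space (PiM UNIV M \<Otimes>\<^sub>M PiM UNIV M). \<forall>\<alpha>. mix (H \<alpha>) (fst w) (snd w) \<in> A \<alpha>}
    \<le> emeasure (PiM UNIV M) {x \<in> space (PiM UNIV M). \<forall>\<alpha>. x \<in> A \<alpha>}"
proof -
  let ?P = "PiM UNIV M"
  interpret PU: prob_space ?P by (rule prob_space_PiM) (rule prob_space)
  define G where "G H = (\<integral>\<^sup>+x. \<integral>\<^sup>+y. (\<Prod>\<alpha>\<in>UNIV. indicator (A \<alpha>) (mix (H \<alpha>) x y)) \<partial>?P \<partial>?P)"
    for H :: "'m \<Rightarrow> 'i set"
  have step: "G H \<le> G (\<lambda>\<alpha>. H \<alpha> - J)" if "finite J" for J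
    using that
  proof (induction J rule: finite_induct)
    case (insert i J)
    have "G H \<le> G (\<lambda>\<alpha>. H \<alpha> - J)" by (rule insert.IH)
    also have "\<dots> \<le> G (\<lambda>\<alpha>. H \<alpha> - J - {i})"
      unfolding G_def
      using replace_one_coordinate[where A = A and H = "\<lambda>\<alpha>. H \<alpha> - J" and i = i, OF fin finm A nested] .
    finally show ?case by (simp only: Diff_insert[symmetric])
  qed simp
  have [measurable]: "{w \<in> space (?P \<Otimes>\<^sub>M ?P). \<forall>\<alpha>. mix (H \<alpha>) (fst w) (snd w) \<in> A \<alpha>} \<in> sets (?P \<Otimes>\<^sub>M ?P)"
    and [measurable]: "{x \<in> space ?P. \<forall>\<alpha>. x \<in> A \<alpha>} \<in> sets ?P"
    using sets.sets_Collect_finite_All[OF _ finm, of "?P \<Otimes>\<^sub>M ?P" "\<lambda>\<alpha> w. mix (H \<alpha>) (fst w) (snd w) \<in> A \<alpha>"]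
      sets.sets_Collect_finite_All[OF _ finm, of ?P "\<lambda>\<alpha> x. x \<in> A \<alpha>"] by auto
  have "emeasure (?P \<Otimes>\<^sub>M ?P) {w \<in> space (?P \<Otimes>\<^sub>M ?P). \<forall>\<alpha>. mix (H \<alpha>) (fst w) (snd w) \<in> A \<alpha>} = G H"
    unfolding G_def prod_indicator_eq[OF finm]
    by (subst PU.emeasure_pair_measure)
       (auto intro!: nn_integral_cong simp: indicator_def space_pair_measure)
  also have "G H \<le> G (\<lambda>\<alpha>. H \<alpha> - UNIV)" by (rule step[OF fin])
  also have "\<dots> = (\<integral>\<^sup>+x. indicator {x \<in> space ?P. \<forall>\<alpha>. x \<in> A \<alpha>} x \<partial>?P)"
    unfolding G_def prod_indicator_eq[OF finm]
    by (intro nn_integral_cong) (simp add: PU.emeasure_space_1 indicator_def)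
  finally show ?thesis by simp
qed

section \<open>From product spaces to independent random variables\<close>

lemma measurable_vec_lambda [measurable]:
  "vec_lambda \<in> measurable (PiM (UNIV :: 'n::finite set) (\<lambda>_. borel)) (borel :: (real ^ 'n) measure)"
  unfolding borel_measurable_euclidean_space[where 'c = "real ^ 'n"]
  by (auto simp: Basis_vec_def inner_axis)

lemma measurable_vec_nth [measurable]:
  "vec_nth \<in> measurable (borel :: (real ^ 'n::finite) measure) (PiM UNIV (\<lambda>_. borel))"
proof (rule measurable_PiM_single')
  show "(\<lambda>x. x $ i) \<in> borel_measurable (borel :: (real ^ 'n) measure)" for i
    by (intro borel_measurable_continuous_onI continuous_intros)
qed auto

lemma replace_coord_vec_lambda: "replace_coord (vec_lambda x) i t = vec_lambda (x(i := t))"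
  by (simp add: replace_coord_def vec_eq_iff)

lemma mix_coords_eq_mix: "mix_coords H x y = vec_lambda (mix H (vec_nth x) (vec_nth y))"
  by (simp add: mix_coords_def mix_def)

text \<open>Independence of the coordinates makes the law of \<open>X\<close> a product measure, and independence of
  the copy makes the joint law of \<open>X\<close> and \<open>Y\<close> the square of it.\<close>

lemma (in prob_space) prob_mix_coords_le:
  fixes X Y :: "'a \<Rightarrow> real ^ 'n" and B :: "'m::finite \<Rightarrow> (real ^ 'n) set" and H :: "'m \<Rightarrow> 'n set"
  assumes B [measurable]: "\<And>\<alpha>. B \<alpha> \<in> sets borel"
    and indep: "indep_vars (\<lambda>_. borel) (\<lambda>i \<omega>. X \<omega> $ i) UNIV"
    and "copy": "independent_copy borel X Y"
    and nested: "\<And>\<alpha> \<beta> i x y.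
      {t. replace_coord x i t \<in> B \<alpha>} \<subseteq> {t. replace_coord y i t \<in> B \<beta>}
      \<or> {t. replace_coord y i t \<in> B \<beta>} \<subseteq> {t. replace_coord x i t \<in> B \<alpha>}"
  shows "\<P>(\<omega> in M. \<forall>\<alpha>. mix_coords (H \<alpha>) (X \<omega>) (Y \<omega>) \<in> B \<alpha>) \<le> \<P>(\<omega> in M. \<forall>\<alpha>. X \<omega> \<in> B \<alpha>)"
proof -
  let ?S = "PiM (UNIV :: 'n set) (\<lambda>_. borel :: real measure)"
  define \<mu> where "\<mu> i = distr M borel (\<lambda>\<omega>. X \<omega> $ i)" for i
  let ?P = "PiM UNIV \<mu>"
  define A where "A \<alpha> = vec_lambda -` B \<alpha> \<inter> space ?S" for \<alpha>
  have XY: "indep_var borel X borel Y" and law: "distr M borel Y = distr M borel X"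
    using "copy" by (auto simp: independent_copy_def)
  have [measurable]: "X \<in> borel_measurable M" "Y \<in> borel_measurable M"
    using XY by (auto dest: indep_var_rv1 indep_var_rv2)
  have coord [measurable]: "(\<lambda>\<omega>. X \<omega> $ i) \<in> borel_measurable M" for i
    using indep by (auto simp: indep_vars_def)
  interpret \<mu>: prob_space "\<mu> i" for i
    unfolding \<mu>_def by (rule prob_space_distr) simp
  interpret product: product_prob_space \<mu> UNIV ..
  have sets_P [measurable_cong]: "sets ?P = sets ?S"
    by (intro sets_PiM_cong) (auto simp: \<mu>_def)
  have A_measurable: "A \<alpha> \<in> sets ?P" for \<alpha>
    unfolding sets_P A_def by measurable
  have A_iff: "x \<in> A \<alpha> \<longleftrightarrow> vec_lambda x \<in> B \<alpha>" for x \<alpha>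
    by (simp add: A_def space_PiM)
  have law_X: "distr M ?S (\<lambda>\<omega>. vec_nth (X \<omega>)) = ?P"
    using indep indep_vars_iff_distr_eq_PiM
        [where I = UNIV and M' = "\<lambda>_. borel" and X = "\<lambda>i \<omega>. X \<omega> $ i"]
    by (simp add: \<mu>_def[abs_def] restrict_UNIV)
  have "distr M ?S (\<lambda>\<omega>. vec_nth (Y \<omega>)) = distr (distr M borel Y) ?S vec_nth"
    by (simp add: distr_distr comp_def)
  also have "\<dots> = distr M ?S (\<lambda>\<omega>. vec_nth (X \<omega>))"
    unfolding law by (simp add: distr_distr comp_def)
  finally have law_Y: "distr M ?S (\<lambda>\<omega>. vec_nth (Y \<omega>)) = ?P"
    using law_X by simp
  have joint: "distr M (?S \<Otimes>\<^sub>M ?S) (\<lambda>\<omega>. (vec_nth (X \<omega>), vec_nth (Y \<omega>))) = ?P \<Otimes>\<^sub>M ?P"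
    using indep_var_compose[OF XY measurable_vec_nth measurable_vec_nth]
    by (simp add: indep_var_distribution_eq comp_def law_X law_Y)
  let ?E = "{w \<in> space (?P \<Otimes>\<^sub>M ?P). \<forall>\<alpha>. mix (H \<alpha>) (fst w) (snd w) \<in> A \<alpha>}"
  let ?F = "{x \<in> space ?P. \<forall>\<alpha>. x \<in> A \<alpha>}"
  have spaces: "space ?P = UNIV" "space (?P \<Otimes>\<^sub>M ?P) = UNIV"
    by (auto simp: space_pair_measure space_PiM \<mu>_def)
  have sets_PP: "sets (?P \<Otimes>\<^sub>M ?P) = sets (?S \<Otimes>\<^sub>M ?S)"
    using sets_P by (intro sets_pair_measure_cong)
  note [measurable] = A_measurable
  have "?E \<in> sets (?P \<Otimes>\<^sub>M ?P)" by measurable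
  then have E: "?E \<in> sets (?S \<Otimes>\<^sub>M ?S)" unfolding sets_PP .
  have "?F \<in> sets ?P" by measurable
  then have F: "?F \<in> sets ?S" unfolding sets_P .
  have "emeasure M {\<omega> \<in> space M. \<forall>\<alpha>. mix_coords (H \<alpha>) (X \<omega>) (Y \<omega>) \<in> B \<alpha>}
      = emeasure (?P \<Otimes>\<^sub>M ?P) ?E"
    unfolding joint[symmetric]
    by (subst emeasure_distr[OF _ E[unfolded joint[symmetric]]])
       (auto intro!: arg_cong[where f = "emeasure M"]
             simp: mix_coords_eq_mix A_iff space_pair_measure space_PiM)
  also have "\<dots> \<le> emeasure ?P ?F"
  proof (rule product.emeasure_mix_le)
    show "{t. x(i := t) \<in> A \<alpha>} \<subseteq> {t. y(i := t) \<in> A \<beta>}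
        \<or> {t. y(i := t) \<in> A \<beta>} \<subseteq> {t. x(i := t) \<in> A \<alpha>}" for \<alpha> \<beta> i x y
      using nested[of "vec_lambda x" i \<alpha> "vec_lambda y" \<beta>]
      by (simp add: replace_coord_vec_lambda A_iff)
  qed (auto intro: A_measurable)
  also have "\<dots> = emeasure M {\<omega> \<in> space M. \<forall>\<alpha>. X \<omega> \<in> B \<alpha>}"
    unfolding law_X[symmetric]
    by (subst emeasure_distr[OF _ F[unfolded law_X[symmetric]]])
       (auto intro!: arg_cong[where f = "emeasure M"] simp: A_iff space_PiM)
  finally show ?thesis
    by (simp add: emeasure_eq_measure)
qed

section \<open>Level sets of monotone functions\<close>

lemma increasing_level_sections_nested:
  assumes "increasing_in_each_component f" and "increasing_in_each_component g"
  shows "{t. a \<le> f (replace_coord x i t)} \<subseteq> {t. b \<le> g (replace_coord y i t)}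
       \<or> {t. b \<le> g (replace_coord y i t)} \<subseteq> {t. a \<le> f (replace_coord x i t)}" (is ?super)
    and "{t. f (replace_coord x i t) \<le> a} \<subseteq> {t. g (replace_coord y i t) \<le> b}
       \<or> {t. g (replace_coord y i t) \<le> b} \<subseteq> {t. f (replace_coord x i t) \<le> a}" (is ?sub)
proof -
  have mono: "f (replace_coord x i s) \<le> f (replace_coord x i t)"
    "g (replace_coord y i s) \<le> g (replace_coord y i t)" if "s \<le> t" for s t
    using assms that by (auto simp: increasing_in_each_component_def mono_def)
  show ?super by (rule upward_closed_nested) (auto dest: mono)
  show ?sub by (rule downward_closed_nested) (auto dest: mono)
qed

lemma decreasing_level_sections_nested:
  assumes "decreasing_in_each_component f" and "decreasing_in_each_component g"
  shows "{t. a \<le> f (replace_coord x i t)} \<subseteq> {t. b \<le> g (replace_coord y i t)}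
       \<or> {t. b \<le> g (replace_coord y i t)} \<subseteq> {t. a \<le> f (replace_coord x i t)}"
    and "{t. f (replace_coord x i t) \<le> a} \<subseteq> {t. g (replace_coord y i t) \<le> b}
       \<or> {t. g (replace_coord y i t) \<le> b} \<subseteq> {t. f (replace_coord x i t) \<le> a}"
proof -
  have "increasing_in_each_component (\<lambda>x. - f x)" "increasing_in_each_component (\<lambda>x. - g x)"
    using assms
    by (auto simp: increasing_in_each_component_def decreasing_in_each_component_def
        mono_def antimono_def)
  \<comment> \<open>Negation turns superlevel sets into sublevel sets, so the two conclusions change places.\<close>
  note neg = increasing_level_sections_nested
    [OF this, where a = "- a" and b = "- b" and x = x and y = y and i = i]
  from neg(2) show "{t. a \<le> f (replace_coord x i t)} \<subseteq> {t. b \<le> g (replace_coord y i t)}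
       \<or> {t. b \<le> g (replace_coord y i t)} \<subseteq> {t. a \<le> f (replace_coord x i t)}" by simp
  from neg(1) show "{t. f (replace_coord x i t) \<le> a} \<subseteq> {t. g (replace_coord y i t) \<le> b}
       \<or> {t. g (replace_coord y i t) \<le> b} \<subseteq> {t. f (replace_coord x i t) \<le> a}" by simp
qed

section \<open>Comparison of the orthant probabilities\<close>

theorem theorem4p1:
  fixes M :: "'a measure"
    and X Y :: "'a \<Rightarrow> real ^ 'n"
    and f :: "'m::finite \<Rightarrow> real ^ 'n \<Rightarrow> real"
    and Z :: "'m \<Rightarrow> 'a \<Rightarrow> real ^ 'n"
    and U V :: "'a \<Rightarrow> real ^ 'm"
    and H :: "'m \<Rightarrow> 'n set"
    and c :: "real ^ 'm"
  assumes "prob_space M"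
    and "\<And>\<alpha>. f \<alpha> \<in> borel_measurable borel"
    and "(\<forall>\<alpha>. increasing_in_each_component (f \<alpha>)) \<or> (\<forall>\<alpha>. decreasing_in_each_component (f \<alpha>))"
    and "prob_space.indep_vars M (\<lambda>_. borel) (\<lambda>i \<omega>. X \<omega> $ i) UNIV"
    and "prob_space.independent_copy M borel X Y"
    and "\<And>\<alpha> \<omega>. Z \<alpha> \<omega> = mix_coords (H \<alpha>) (X \<omega>) (Y \<omega>)"
    and "\<And>\<omega>. U \<omega> = (\<chi> \<alpha>. f \<alpha> (Z \<alpha> \<omega>))"
    and "\<And>\<omega>. V \<omega> = (\<chi> \<alpha>. f \<alpha> (X \<omega>))"
  shows "\<P>(\<omega> in M. U \<omega> \<ge> c) \<le> \<P>(\<omega> in M. V \<omega> \<ge> c)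
       \<and> \<P>(\<omega> in M. U \<omega> \<le> c) \<le> \<P>(\<omega> in M. V \<omega> \<le> c)"
proof -
  interpret prob_space M by fact
  note [measurable] = assms(2)
  note compare = prob_mix_coords_le[OF _ assms(4) assms(5), of _ H]
  have "{x. c $ \<alpha> \<le> f \<alpha> x} \<in> sets borel" "{x. f \<alpha> x \<le> c $ \<alpha>} \<in> sets borel" for \<alpha>
    by measurable
  note level_sets = this
  have super: "{t. c $ \<alpha> \<le> f \<alpha> (replace_coord x i t)} \<subseteq> {t. c $ \<beta> \<le> f \<beta> (replace_coord y i t)}
       \<or> {t. c $ \<beta> \<le> f \<beta> (replace_coord y i t)} \<subseteq> {t. c $ \<alpha> \<le> f \<alpha> (replace_coord x i t)}"
    and sub: "{t. f \<alpha> (replace_coord x i t) \<le> c $ \<alpha>} \<subseteq> {t. f \<beta> (replace_coord y i t) \<le> c $ \<beta>}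
       \<or> {t. f \<beta> (replace_coord y i t) \<le> c $ \<beta>} \<subseteq> {t. f \<alpha> (replace_coord x i t) \<le> c $ \<alpha>}"
    for \<alpha> \<beta> i x y
    using assms(3) increasing_level_sections_nested[of "f \<alpha>" "f \<beta>"]
      decreasing_level_sections_nested[of "f \<alpha>" "f \<beta>"] by metis+
  show ?thesis
    using compare[of "\<lambda>\<alpha>. {x. c $ \<alpha> \<le> f \<alpha> x}", OF level_sets(1)] super
      compare[of "\<lambda>\<alpha>. {x. f \<alpha> x \<le> c $ \<alpha>}", OF level_sets(2)] sub
    by (simp add: less_eq_vec_def assms(6-8))
qed

end
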